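(* Let $0<q<1$ be fixed. Then for $x>0$, we have $$\psi_q'(x+1/2)\leq\frac{(\ln q)^2q^{x+1/2}}{(1-q)(1-q^x)}.$$
   Context: For $0<q<1$ and $x>0$, the $q$-gamma function is $$\Gamma_q(x)=\frac{(q;q)_\infty}{(q^x;q)_\infty}(1-q)^{1-x},\qquad (a;q)_\infty=\prod_{n=0}^\infty(1-aq^n),$$ and $\psi_q=\Gamma_q'/\Gamma_q$ is its logarithmic derivative on $(0,+\infty)$. *)

theory Defs
  imports "HOL-Analysis.Analysis"
begin

definition qpoch_inf :: "real \<Rightarrow> real \<Rightarrow> real" where
  "qpoch_inf a q = (\<Prod>n. 1 - a * q ^ n)"

(* Intended for 0 < q < 1 and x > 0; values outside this range are irrelevant. *)
definition q_Gamma :: "real \<Rightarrow> real \<Rightarrow> real" where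
  "q_Gamma q x = qpoch_inf q q / qpoch_inf (q powr x) q * (1 - q) powr (1 - x)"

definition q_Digamma :: "real \<Rightarrow> real \<Rightarrow> real" where
  "q_Digamma q x = deriv (q_Gamma q) x / q_Gamma q x"

end

theory Submission
  imports Defs
begin

text \<open>
  Expanding the logarithm of the product termwise, \<open>\<psi>\<^sub>q' y = (ln q)\<^sup>2 \<Sum>\<^sub>n v\<^sub>n / (1 - v\<^sub>n)\<^sup>2\<close>
  with \<open>v\<^sub>n = q\<^bsup>n+y\<^esup>\<close>.  For \<open>y = x + 1/2\<close> put \<open>u = q\<^bsup>n+x\<^esup>\<close> and \<open>s = \<surd>q\<close>, so that \<open>v\<^sub>n = s u\<close>.
  Since \<open>2 s \<le> 1 + s\<^sup>2\<close>, we have \<open>(1 - u) (1 - q u) \<le> (1 - s u)\<^sup>2\<close>; hence the \<open>n\<close>-th term is at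
  most \<open>s u / ((1 - u) (1 - q u))\<close>, and these bounds telescope to the right-hand side.
\<close>

text \<open>Keeps the denominators away from 0 uniformly in \<open>n\<close> and in
  \<open>y >= c\<close>. The geometric majorants below rest on it.\<close>

lemma one_minus_powr_le:
  fixes q c y :: real
  assumes "0 < q" "q < 1" "0 < c" "c \<le> y"
  shows "1 - q powr c \<le> 1 - q powr y * q ^ n"
proof -
  have "q powr y \<le> q powr c" using assms by (simp add: powr_mono')
  moreover have "q ^ n \<le> 1" using assms by (simp add: power_le_one)
  ultimately show ?thesis
    using assms by (smt (verit) mult_left_le powr_gt_zero)
qed

lemma powr_mult_power_less_one:
  fixes q y :: real
  assumes "0 < q" "q < 1" "0 < y"
  shows "q powr y * q ^ n < 1"
  using one_minus_powr_le[of q y y n] powr01_less_one[of q y] assms by linarith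

text \<open>Termwise differentiation, used for the logarithmic series and again for its derivative.
  The bound cannot be expected uniformly near 0, where the denominators vanish, so it is asked only
  on \<open>{x / 2..}\<close>: this set is convex, has \<open>x\<close> in its interior and stays
  away from 0. There the M-test applies to the series of derivatives.\<close>

lemma suminf_has_field_derivative_geometric:
  fixes f f' :: "nat \<Rightarrow> real \<Rightarrow> real" and q K x :: real
  assumes q: "0 < q" "q < 1" and x: "0 < x"
    and deriv: "\<And>n y. 0 < y \<Longrightarrow> (f n has_real_derivative f' n y) (at y)"
    and bound: "\<And>n y. x / 2 \<le> y \<Longrightarrow> \<bar>f' n y\<bar> \<le> K * q ^ n"
    and summable: "summable (\<lambda>n. f n x)"
  shows "((\<lambda>y. \<Sum>n. f n y) has_real_derivative (\<Sum>n. f' n x)) (at x)"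
proof (rule has_field_derivative_series'(2))
  show "convex {x / 2..}" by simp
  show "(f n has_real_derivative f' n y) (at y within {x / 2..})" if "y \<in> {x / 2..}" for n y
    using deriv[of y n] that x by (auto intro: has_field_derivative_at_within)
  show "uniformly_convergent_on {x / 2..} (\<lambda>n y. \<Sum>i<n. f' i y)"
    by (rule Weierstrass_m_test'[where M = "\<lambda>n. K * q ^ n"])
       (use q bound in \<open>auto intro!: summable_mult summable_geometric\<close>)
  show "x \<in> {x / 2..}" "x \<in> interior {x / 2..}" using x by auto
qed (fact summable)

context
  fixes q :: real
  assumes q: "0 < q" "q < 1"
begin

text \<open>For 0 < v < 1, ln t <= t - 1 at t = 1/(1 - v) gives |ln (1 - v)| <= v/(1 - v), which is
  geometrically small.\<close>

lemma summable_ln_one_minus: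
  assumes "0 < x"
  shows "summable (\<lambda>n. ln (1 - q powr x * q ^ n))"
proof (rule summable_comparison_test')
  let ?K = "1 / (1 - q powr x)"
  show "summable (\<lambda>n. ?K * q ^ n)"
    using q by (intro summable_mult summable_geometric) auto
  fix n
  define v where "v = q powr x * q ^ n"
  have v: "0 < v" "v < 1" "v \<le> q ^ n"
    using q assms powr_mult_power_less_one[of q x n]
    by (auto simp: v_def intro!: mult_left_le_one_le powr_le1)
  have px: "q powr x < 1" using q assms by (simp add: powr01_less_one)
  have "\<bar>ln (1 - v)\<bar> = ln (1 / (1 - v))" using v by (simp add: ln_div)
  also have "\<dots> \<le> 1 / (1 - v) - 1" using v by (intro ln_le_minus_one) auto
  also have "\<dots> = v / (1 - v)" using v by (simp add: field_simps)
  also have "\<dots> \<le> q ^ n / (1 - q powr x)"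
    using v q px assms one_minus_powr_le[of q x x n] by (intro frac_le) (auto simp: v_def)
  finally show "norm (ln (1 - q powr x * q ^ n)) \<le> ?K * q ^ n" by (simp add: v_def)
qed

text \<open>All factors are positive, so the product becomes the exponential of a series that can be
  differentiated termwise.\<close>

lemma qpoch_inf_powr:
  assumes "0 < x"
  shows "qpoch_inf (q powr x) q = exp (\<Sum>n. ln (1 - q powr x * q ^ n))"
proof -
  have "1 - q powr x * q ^ n = exp (ln (1 - q powr x * q ^ n))" for n
    using powr_mult_power_less_one[of q x n] q assms by simp
  then have "qpoch_inf (q powr x) q = (\<Prod>n. exp (ln (1 - q powr x * q ^ n)))"
    unfolding qpoch_inf_def by simp
  also have "\<dots> = exp (\<Sum>n. ln (1 - q powr x * q ^ n))"
    by (rule prodinf_exp[OF summable_ln_one_minus[OF assms]])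
  finally show ?thesis .
qed

text \<open>The case \<open>k = 1\<close> serves the first derivative of the logarithmic series,
  \<open>k = 2\<close> the second. Taking \<open>c = x/2\<close> gives the uniform bound that
  termwise differentiation needs.\<close>

lemma abs_q_powr_quotient_le:
  assumes "0 < c" "c \<le> y"
  shows "\<bar>q powr y * q ^ n / (1 - q powr y * q ^ n) ^ k\<bar> \<le> q ^ n / (1 - q powr c) ^ k"
proof -
  define v where "v = q powr y * q ^ n"
  have v: "0 < v" "v \<le> q ^ n" "v < 1" "1 - q powr c \<le> 1 - v"
    using q assms one_minus_powr_le[of q c y n] powr_mult_power_less_one[of q y n]
    by (auto simp: v_def intro!: mult_left_le_one_le powr_le1)
  have c: "0 < 1 - q powr c" using q assms by (simp add: powr01_less_one)
  have "v / (1 - v) ^ k \<le> q ^ n / (1 - q powr c) ^ k"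
    using v c by (intro frac_le power_mono zero_less_power) auto
  moreover have "0 \<le> v / (1 - v) ^ k" using v by simp
  ultimately show ?thesis by (simp add: v_def)
qed

lemma summable_q_powr_quotient:
  assumes "0 < x"
  shows "summable (\<lambda>n. q powr x * q ^ n / (1 - q powr x * q ^ n) ^ k)"
proof (rule summable_comparison_test')
  show "summable (\<lambda>n. q ^ n / (1 - q powr x) ^ k)"
    using q by (intro summable_divide summable_geometric) auto
  show "norm (q powr x * q ^ n / (1 - q powr x * q ^ n) ^ k) \<le> q ^ n / (1 - q powr x) ^ k" for n
    using abs_q_powr_quotient_le[OF assms order_refl] by simp
qed

lemma suminf_ln_one_minus_has_derivative:
  assumes "0 < x"
  shows "((\<lambda>y. \<Sum>n. ln (1 - q powr y * q ^ n)) has_real_derivative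
           (\<Sum>n. - ln q * (q powr x * q ^ n / (1 - q powr x * q ^ n)))) (at x)"
proof (rule suminf_has_field_derivative_geometric[where q = q and K = "\<bar>ln q\<bar> / (1 - q powr (x/2))"])
  fix n y assume "x / 2 \<le> y"
  then have "\<bar>q powr y * q ^ n / (1 - q powr y * q ^ n)\<bar> \<le> q ^ n / (1 - q powr (x/2))"
    using abs_q_powr_quotient_le[of "x/2" y n 1] assms by simp
  from mult_left_mono[OF this, of "\<bar>ln q\<bar>"]
  show "\<bar>- ln q * (q powr y * q ^ n / (1 - q powr y * q ^ n))\<bar> \<le> \<bar>ln q\<bar> / (1 - q powr (x/2)) * q ^ n"
    by (simp only: abs_mult abs_minus_cancel) simp
next
  fix n and y :: real assume "0 < y"
  then show "((\<lambda>y. ln (1 - q powr y * q ^ n)) has_real_derivative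
      - ln q * (q powr y * q ^ n / (1 - q powr y * q ^ n))) (at y)"
    using powr_mult_power_less_one[of q y n] q
    by (auto intro!: derivative_eq_intros simp: field_simps)
qed (use assms q summable_ln_one_minus in auto)

lemma suminf_q_powr_quotient_has_derivative:
  assumes "0 < x"
  shows "((\<lambda>y. \<Sum>n. - ln q * (q powr y * q ^ n / (1 - q powr y * q ^ n))) has_real_derivative
           (\<Sum>n. - (ln q)\<^sup>2 * (q powr x * q ^ n / (1 - q powr x * q ^ n)\<^sup>2))) (at x)"
proof (rule suminf_has_field_derivative_geometric[where q = q and K = "(ln q)\<^sup>2 / (1 - q powr (x/2))\<^sup>2"])
  fix n y assume "x / 2 \<le> y"
  then have "\<bar>q powr y * q ^ n / (1 - q powr y * q ^ n)\<^sup>2\<bar> \<le> q ^ n / (1 - q powr (x/2))\<^sup>2"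
    using assms by (intro abs_q_powr_quotient_le) auto
  from mult_left_mono[OF this, of "(ln q)\<^sup>2"]
  show "\<bar>- (ln q)\<^sup>2 * (q powr y * q ^ n / (1 - q powr y * q ^ n)\<^sup>2)\<bar>
      \<le> (ln q)\<^sup>2 / (1 - q powr (x/2))\<^sup>2 * q ^ n"
    by (simp only: abs_mult abs_minus_cancel abs_power2) simp
next
  fix n and y :: real assume "0 < y"
  then show "((\<lambda>y. - ln q * (q powr y * q ^ n / (1 - q powr y * q ^ n))) has_real_derivative
      - (ln q)\<^sup>2 * (q powr y * q ^ n / (1 - q powr y * q ^ n)\<^sup>2)) (at y)"
    using powr_mult_power_less_one[of q y n] q
    by (auto intro!: derivative_eq_intros simp: divide_simps power2_eq_square) (simp add: algebra_simps)
qed (use assms q summable_mult[OF summable_q_powr_quotient[of x 1], of "- ln q"] in auto)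

lemma q_Digamma_series:
  assumes "0 < x"
  shows "q_Digamma q x = - ln (1 - q) - (\<Sum>n. - ln q * (q powr x * q ^ n / (1 - q powr x * q ^ n)))"
proof -
  define F where "F = (\<lambda>y. \<Sum>n. ln (1 - q powr y * q ^ n))"
  define F' where "F' = (\<Sum>n. - ln q * (q powr x * q ^ n / (1 - q powr x * q ^ n)))"
  \<comment> \<open>The factor \<open>exp (F 1)\<close> is the numerator (q;q)_inf, since
    \<open>q powr 1 = q\<close>. In this exponential form the logarithmic derivative can be read
    off.\<close>
  define G where "G = (\<lambda>y. exp (F 1) * exp (- F y) * (1 - q) powr (1 - y))"
  have eq: "q_Gamma q y = G y" if "0 < y" for y
    using qpoch_inf_powr[OF that] qpoch_inf_powr[of 1] q
    by (simp add: q_Gamma_def G_def F_def exp_minus divide_inverse)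
  have "(F has_real_derivative F') (at x)"
    unfolding F_def F'_def by (rule suminf_ln_one_minus_has_derivative[OF assms])
  then have "(G has_real_derivative G x * (- ln (1 - q) - F')) (at x)"
    unfolding G_def using q by (auto intro!: derivative_eq_intros simp: algebra_simps)
  \<comment> \<open>\<open>q_Gamma q\<close> and \<open>G\<close> are compared only for positive
    arguments; equality near \<open>x\<close> is enough to transfer \<open>deriv\<close>.\<close>
  moreover have "\<forall>\<^sub>F y in nhds x. q_Gamma q y = G y"
    using eventually_nhds_in_open[of "{0<..}" x] assms eq by (auto elim: eventually_mono)
  ultimately have "deriv (q_Gamma q) x = G x * (- ln (1 - q) - F')"
    by (metis DERIV_imp_deriv deriv_cong_ev)
  moreover have "G x \<noteq> 0" using q by (simp add: G_def)
  ultimately show ?thesis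
    using eq[OF assms] by (simp add: q_Digamma_def F'_def)
qed

lemma deriv_q_Digamma:
  assumes "0 < x"
  shows "deriv (q_Digamma q) x = - (\<Sum>n. - (ln q)\<^sup>2 * (q powr x * q ^ n / (1 - q powr x * q ^ n)\<^sup>2))"
proof -
  let ?D = "\<lambda>y. - ln (1 - q) - (\<Sum>n. - ln q * (q powr y * q ^ n / (1 - q powr y * q ^ n)))"
  have "\<forall>\<^sub>F y in nhds x. q_Digamma q y = ?D y"
    using eventually_nhds_in_open[of "{0<..}" x] assms q_Digamma_series by (auto elim: eventually_mono)
  then have "deriv (q_Digamma q) x = deriv ?D x" by (intro deriv_cong_ev) auto
  also have "\<dots> = 0 - (\<Sum>n. - (ln q)\<^sup>2 * (q powr x * q ^ n / (1 - q powr x * q ^ n)\<^sup>2))"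
    by (intro DERIV_imp_deriv DERIV_diff suminf_q_powr_quotient_has_derivative[OF assms]) auto
  finally show ?thesis by simp
qed

lemma suminf_q_powr_square_quotient_le:
  assumes "0 < x"
  shows "(\<Sum>n. q powr (x + 1/2) * q ^ n / (1 - q powr (x + 1/2) * q ^ n)\<^sup>2)
           \<le> q powr (x + 1/2) / ((1 - q) * (1 - q powr x))"
proof -
  define s where "s = sqrt q"
  define u where "u = (\<lambda>n. q powr x * q ^ n)"
  \<comment> \<open>Chosen by partial fractions: u/(1 - u) - q u/(1 - q u) = (1 - q) u/((1 - u)(1 -
    q u)), and q u is the next value of \<open>u\<close>.\<close>
  define b where "b = (\<lambda>n. s * u n / ((1 - q) * (1 - u n)))"
  have s: "0 < s" "s < 1" "q = s\<^sup>2" using q by (auto simp: s_def)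
  have half: "q powr (x + 1/2) = s * q powr x"
    using q by (simp add: powr_add s_def powr_half_sqrt)
  have u: "0 < u n" "u n < 1" "u (Suc n) = q * u n" for n
    using q powr_mult_power_less_one[of q x n] assms by (auto simp: u_def)
  have "u \<longlonglongrightarrow> q powr x * 0"
    unfolding u_def using q by (intro tendsto_intros LIMSEQ_power_zero) auto
  \<comment> \<open>Since \<open>b\<close> tends to 0, the telescoping sum is exactly
    \<open>b 0\<close>, which is the claimed bound.\<close>
  then have "b \<longlonglongrightarrow> s * 0 / ((1 - q) * (1 - 0))"
    unfolding b_def using q by (intro tendsto_intros) auto
  then have sums: "(\<lambda>n. b n - b (Suc n)) sums b 0"
    using telescope_sums'[of b 0] by simp
  have le: "s * u n / (1 - s * u n)\<^sup>2 \<le> b n - b (Suc n)" for n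
  proof -
    have qu: "q * u n < 1" using u(2)[of "Suc n"] u(3) by simp
    have su: "s * u n < 1" using s u[of n] by (smt (verit) mult_left_le_one_le)
    have "b n - b (Suc n) = s * u n / ((1 - u n) * (1 - q * u n))"
      using qu u[of n] q unfolding b_def u(3)
      by (simp add: divide_simps) (simp add: algebra_simps)
    moreover have "(1 - u n) * (1 - q * u n) \<le> (1 - s * u n)\<^sup>2"
    proof -
      \<comment> \<open>With q = s^2 the constant and quadratic terms in u cancel, leaving u (1 +
        s^2 - 2 s).\<close>
      have "(1 - s * u n)\<^sup>2 - (1 - u n) * (1 - q * u n) = u n * (1 - s)\<^sup>2"
        by (simp add: s(3) power2_eq_square algebra_simps)
      also have "\<dots> \<ge> 0" using u(1)[of n] by simp
      finally show ?thesis by simp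
    qed
    ultimately show ?thesis
      using s u[of n] qu su by (simp add: frac_le)
  qed
  have "(\<Sum>n. s * u n / (1 - s * u n)\<^sup>2) \<le> (\<Sum>n. b n - b (Suc n))"
    using le summable_q_powr_quotient[of "x + 1/2" 2] assms sums
    by (intro suminf_le) (auto simp: half u_def mult.assoc sums_iff)
  also have "\<dots> = b 0" using sums by (simp add: sums_iff)
  finally show ?thesis by (simp add: half u_def b_def mult.assoc)
qed

end

theorem corollary3p3:
  fixes q x :: real
  assumes "0 < q" and "q < 1" and "x > 0"
  shows "deriv (q_Digamma q) (x + 1/2)
           \<le> (ln q)\<^sup>2 * q powr (x + 1/2) / ((1 - q) * (1 - q powr x))"
proof -
  let ?t = "\<lambda>n. q powr (x + 1/2) * q ^ n / (1 - q powr (x + 1/2) * q ^ n)\<^sup>2"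
  have "summable ?t"
    using assms by (intro summable_q_powr_quotient) auto
  then have "deriv (q_Digamma q) (x + 1/2) = (ln q)\<^sup>2 * (\<Sum>n. ?t n)"
    \<comment> \<open>The factor \<open>- (ln q)\<^sup>2\<close> is pulled out of the convergent
      series; its sign cancels the outer minus.\<close>
    using deriv_q_Digamma[of q "x + 1/2"] suminf_mult[of ?t "- (ln q)\<^sup>2"] assms by simp
  also have "\<dots> \<le> (ln q)\<^sup>2 * (q powr (x + 1/2) / ((1 - q) * (1 - q powr x)))"
    using assms by (intro mult_left_mono suminf_q_powr_square_quotient_le) auto
  finally show ?thesis by simp
qed

end
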